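(* Let $\delta>0$ and let $x:[t_0,+\infty[\to\mathcal H$ be a solution trajectory of $$\ddot x(t)+\delta\sqrt{\epsilon(t)}\,\dot x(t)+\nabla f(x(t))+\epsilon(t)x(t)=0 .$$ Suppose that $\epsilon(\cdot)$ satisfies the controlled decay condition $(\mathrm{CD})_K$ for some $K>0$, with associated time $t_1\ge t_0$ (see context). Then, for all $t\ge t_1$, $$f(x(t))-\min_{\mathcal H} f\le \frac{K\|x^*\|^2}{2}\,\frac{1}{\mathfrak M(t)}\int_{t_1}^t \epsilon^{\frac32}(s)\,\mathfrak M(s)\,ds+\frac{C}{\mathfrak M(t)},$$ where $$\mathfrak M(t)=\exp\left(\int_{t_1}^t\mu(s)\,ds\right),\qquad \mu(t)=-\frac{\dot\epsilon(t)}{2\epsilon(t)}+(\delta-K)\sqrt{\epsilon(t)},$$ and $$C=\big(f(x(t_1))-f(x^* )\big)+\frac{\epsilon(t_1)}{2}\|x(t_1)\|^2+\frac12\left\|K\sqrt{\epsilon(t_1)}\,(x(t_1)-x^* )+\dot x(t_1)\right\|^2 .$$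
   Context: $\mathcal H$ is a real Hilbert space with scalar product $\langle\cdot,\cdot\rangle$ and norm $\|\cdot\|$. The function $f:\mathcal H\to\mathbb R$ is convex and differentiable, and $\nabla f$ is Lipschitz continuous on bounded sets. $S=\operatorname{argmin} f\ne\emptyset$, and $x^*$ is the element of minimum norm of $S$. The function $\epsilon:[t_0,+\infty[\to\mathbb R^+$ is nonincreasing, of class $C^1$, takes positive values, and $\lim_{t\to\infty}\epsilon(t)=0$. Condition $(\mathrm{CD})_K$: given $\delta>0$, the nonincreasing function $\epsilon$ satisfies $(\mathrm{CD})_K$ if there exists $t_1\ge t_0$ such that for all $t\ge t_1$ $$\left(\frac{1}{\sqrt{\epsilon}}\right)'(t)\le\min(2K-\delta,\ \delta-K),$$ where $K$ is a parameter such that $\frac{\delta}{2}<K<\delta$ if $0<\delta\le2$, and $\frac{\delta+\sqrt{\delta^2-4}}{2}<K<\delta$ if $\delta>2$. Solutions are classical (twice differentiable) solutions on $[t_0,+\infty[$. *)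

theory Defs
  imports "HOL-Analysis.Analysis"
begin

definition argmin_set :: "('a \<Rightarrow> real) \<Rightarrow> 'a set" where
  "argmin_set f = {z. is_arg_min f (\<lambda>_. True) z}"

definition lipschitz_on_bounded_sets ::
  "('a::metric_space \<Rightarrow> 'b::metric_space) \<Rightarrow> bool" where
  "lipschitz_on_bounded_sets g \<longleftrightarrow> (\<forall>B. bounded B \<longrightarrow> (\<exists>L. L-lipschitz_on B g))"

(* eps' is the derivative of eps on [t0, +oo), one-sided at t0; values of eps and eps'
   outside [t0, +oo) are irrelevant. *)
definition regularization_parameter ::
  "real \<Rightarrow> (real \<Rightarrow> real) \<Rightarrow> (real \<Rightarrow> real) \<Rightarrow> bool" where
  "regularization_parameter t0 eps eps' \<longleftrightarrow>
     (\<forall>t\<ge>t0. 0 < eps t) \<and>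
     antimono_on {t0..} eps \<and>
     (\<forall>t\<ge>t0. (eps has_real_derivative eps' t) (at t within {t0..})) \<and>
     continuous_on {t0..} eps' \<and>
     (eps \<longlongrightarrow> 0) at_top"

definition admissible_K :: "real \<Rightarrow> real \<Rightarrow> bool" where
  "admissible_K \<delta> K \<longleftrightarrow>
     (if \<delta> \<le> 2 then \<delta> / 2 < K \<and> K < \<delta>
      else (\<delta> + sqrt (\<delta>\<^sup>2 - 4)) / 2 < K \<and> K < \<delta>)"

(* Controlled decay condition with explicit witness t1: the condition (CD)_K itself is
   the existence of such a t1. *)
definition controlled_decay_from ::
  "real \<Rightarrow> real \<Rightarrow> real \<Rightarrow> (real \<Rightarrow> real) \<Rightarrow> real \<Rightarrow> bool" where
  "controlled_decay_from t0 \<delta> K eps t1 \<longleftrightarrow>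
     admissible_K \<delta> K \<and> t0 \<le> t1 \<and>
     (\<forall>t\<ge>t1. \<exists>D. ((\<lambda>s. 1 / sqrt (eps s)) has_real_derivative D) (at t within {t0..}) \<and>
                 D \<le> min (2 * K - \<delta>) (\<delta> - K))"

(* Classical solution on [t0, +oo); x' and x'' are the first and second derivatives of x,
   one-sided at t0. *)
definition solution_trajectory ::
  "real \<Rightarrow> real \<Rightarrow> (real \<Rightarrow> real) \<Rightarrow> ('a::real_inner \<Rightarrow> 'a) \<Rightarrow>
   (real \<Rightarrow> 'a) \<Rightarrow> (real \<Rightarrow> 'a) \<Rightarrow> (real \<Rightarrow> 'a) \<Rightarrow> bool" where
  "solution_trajectory t0 \<delta> eps gradf x x' x'' \<longleftrightarrow>
     (\<forall>t\<ge>t0. (x has_vector_derivative x' t) (at t within {t0..}) \<and>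
             (x' has_vector_derivative x'' t) (at t within {t0..}) \<and>
             x'' t + (\<delta> * sqrt (eps t)) *\<^sub>R x' t + gradf (x t) + eps t *\<^sub>R x t = 0)"

definition \<mu>_fun :: "real \<Rightarrow> real \<Rightarrow> (real \<Rightarrow> real) \<Rightarrow> (real \<Rightarrow> real) \<Rightarrow> real \<Rightarrow> real" where
  "\<mu>_fun \<delta> K eps eps' t = - eps' t / (2 * eps t) + (\<delta> - K) * sqrt (eps t)"

definition M_fun ::
  "real \<Rightarrow> real \<Rightarrow> (real \<Rightarrow> real) \<Rightarrow> (real \<Rightarrow> real) \<Rightarrow> real \<Rightarrow> real \<Rightarrow> real" where
  "M_fun \<delta> K eps eps' t1 t = exp (integral {t1..t} (\<mu>_fun \<delta> K eps eps'))"

definition C_const ::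
  "real \<Rightarrow> ('a::real_inner \<Rightarrow> real) \<Rightarrow> (real \<Rightarrow> real) \<Rightarrow> (real \<Rightarrow> 'a) \<Rightarrow> (real \<Rightarrow> 'a) \<Rightarrow>
   'a \<Rightarrow> real \<Rightarrow> real" where
  "C_const K f eps x x' xstar t1 =
     (f (x t1) - f xstar) + eps t1 / 2 * (norm (x t1))\<^sup>2
     + 1 / 2 * (norm ((K * sqrt (eps t1)) *\<^sub>R (x t1 - xstar) + x' t1))\<^sup>2"

end

theory Submission
  imports Defs
begin

text \<open>
  The proof is a Lyapunov argument. Along a trajectory consider the energy
  \[ E(t) = f(x(t)) - f(x^*) + \frac{\epsilon(t)}{2} \|x(t)\|^2
            + \frac12 \|K \sqrt{\epsilon(t)}\, (x(t) - x^*) + \dot x(t)\|^2, \]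
  which dominates the gap to the minimum and whose value at the initial time is \<open>C\<close>. The rate
  \<open>\<mu>\<close> is the one for which the cross term in \<open>\<langle>x - x\<^sup>*, x'\<rangle>\<close> disappears from \<open>E' + \<mu> E\<close>. After the
  gradient inequality for \<open>f\<close> at \<open>x\<^sup>*\<close> has been used, what remains besides the source term
  \<open>K/2 * \<epsilon>\<^sup>3\<^sup>/\<^sup>2 * \<parallel>x\<^sup>*\<parallel>\<^sup>2\<close> is a combination of \<open>f(x) - f(x\<^sup>*)\<close>, \<open>\<parallel>x\<parallel>\<^sup>2\<close>, \<open>\<parallel>x - x\<^sup>*\<parallel>\<^sup>2\<close> and \<open>\<parallel>x'\<parallel>\<^sup>2\<close>.
  Writing \<open>r\<close> for the derivative of \<open>1 / sqrt \<epsilon>\<close>, its coefficients are nonpositive because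
  \<open>r \<ge> 0\<close> (monotonicity of \<open>\<epsilon>\<close>), \<open>r \<le> 2 K - \<delta>\<close> and \<open>r \<le> \<delta> - K\<close> (controlled decay), and
  \<open>K (\<delta> - K) \<le> 1\<close> (admissibility of \<open>K\<close>). This is \<open>energy_dissipation\<close>.

  Hence \<open>E' + \<mu> E \<le> K/2 * \<epsilon>\<^sup>3\<^sup>/\<^sup>2 * \<parallel>x\<^sup>*\<parallel>\<^sup>2\<close>, and multiplying by the integrating factor \<open>exp (\<integral>\<mu>)\<close> and
  integrating (\<open>linear_differential_inequality\<close>) gives the estimate.
\<close>

section \<open>Convex functions and monotone functions\<close>

text \<open>
  Restricting to the segment from \<open>y\<close> to \<open>z\<close> reduces this to the tangent inequality for convex
  functions of one real variable.
\<close>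

lemma convex_on_gradient_inequality:
  fixes f :: "'a::real_inner \<Rightarrow> real"
  assumes "convex_on UNIV f" and "GDERIV f y :> g"
  shows "f y + inner g (z - y) \<le> f z"
proof -
  define h where "h s = f (y + s *\<^sub>R (z - y))" for s :: real
  have affine: "y + ((1 - t) * a + t * b) *\<^sub>R (z - y) =
      (1 - t) *\<^sub>R (y + a *\<^sub>R (z - y)) + t *\<^sub>R (y + b *\<^sub>R (z - y))" for a b t :: real
    by (simp add: algebra_simps)
  have "convex_on UNIV h"
  proof (rule convex_onI)
    fix t a b :: real
    assume "0 < t" "t < 1"
    then show "h ((1 - t) *\<^sub>R a + t *\<^sub>R b) \<le> (1 - t) * h a + t * h b"
      using convex_onD[OF assms(1), of t "y + a *\<^sub>R (z - y)" "y + b *\<^sub>R (z - y)"]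
      by (simp add: h_def affine)
  qed simp
  moreover have "(h has_real_derivative inner g (z - y)) (at 0)"
  proof -
    have "(f has_derivative (\<lambda>k. inner k g)) (at (y + 0 *\<^sub>R (z - y)))"
      using assms(2) by (simp add: gderiv_def)
    moreover have "((\<lambda>s. y + s *\<^sub>R (z - y)) has_derivative (\<lambda>s. s *\<^sub>R (z - y))) (at 0)"
      by (auto intro!: derivative_eq_intros)
    ultimately have "(h has_derivative (\<lambda>s. inner (s *\<^sub>R (z - y)) g)) (at 0)"
      unfolding h_def by (rule has_derivative_compose[rotated])
    then show ?thesis
      by (simp add: has_field_derivative_def inner_commute mult_commute_abs)
  qed
  ultimately have "inner g (z - y) * (1 - 0) \<le> h 1 - h 0"
    by (intro convex_on_imp_above_tangent[where A = UNIV and c = 0]) auto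
  then show ?thesis
    by (simp add: h_def)
qed

lemma at_within_atLeast_neq_bot:
  fixes a t :: real
  assumes "a \<le> t"
  shows "at t within {a..} \<noteq> bot"
proof -
  have "at_right t \<le> at t within {a..}"
    using assms by (intro at_le) auto
  then show ?thesis
    using trivial_limit_at_right_real[of t] le_bot by force
qed

lemma antimono_on_atLeast_derivative_nonpos:
  fixes g :: "real \<Rightarrow> real"
  assumes "antimono_on {a..} g" and "(g has_real_derivative D) (at t within {a..})" and "a \<le> t"
  shows "D \<le> 0"
proof -
  have lim: "((\<lambda>s. (g s - g t) / (s - t)) \<longlongrightarrow> D) (at t within {a..})"
    using assms(2) by (simp add: has_field_derivative_iff)
  have "\<forall>\<^sub>F s in at t within {a..}. (g s - g t) / (s - t) \<le> 0"
    unfolding eventually_at_filter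
  proof (rule always_eventually, intro allI impI)
    fix s
    assume "s \<noteq> t" "s \<in> {a..}"
    then show "(g s - g t) / (s - t) \<le> 0"
      using assms(1,3) monotone_onD[OF assms(1), of s t] monotone_onD[OF assms(1), of t s]
      by (cases "s < t") (auto simp: divide_nonneg_neg divide_nonpos_pos)
  qed
  moreover have "at t within {a..} \<noteq> bot"
    using assms(3) at_within_atLeast_neq_bot by blast
  ultimately show ?thesis
    using lim tendsto_upperbound by blast
qed

section \<open>The parameter condition and the integrating factor\<close>

text \<open>
  For \<open>\<delta> \<le> 2\<close> this is the arithmetic-geometric mean inequality, and for \<open>\<delta> > 2\<close> it holds because
  \<open>K\<close> exceeds the larger root of \<open>X\<^sup>2 - \<delta> X + 1\<close>.
\<close>

lemma admissible_K_imp_product_le_1: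
  assumes "admissible_K \<delta> K" and "0 < \<delta>"
  shows "K * (\<delta> - K) \<le> 1"
proof (cases "\<delta> \<le> 2")
  case True
  have "4 * (K * (\<delta> - K)) = \<delta>\<^sup>2 - (2 * K - \<delta>)\<^sup>2"
    by algebra
  moreover have "\<delta>\<^sup>2 \<le> 2\<^sup>2"
    using True assms(2) by (intro power_mono) auto
  ultimately show ?thesis
    using zero_le_power2[of "2 * K - \<delta>"] by (simp only: power2_eq_square[of 2])
next
  case False
  then have "sqrt (\<delta>\<^sup>2 - 4) \<le> 2 * K - \<delta>"
    using assms(1) by (simp add: admissible_K_def)
  then have "\<delta>\<^sup>2 - 4 \<le> (2 * K - \<delta>)\<^sup>2"
    using real_sqrt_le_iff sqrt_le_D by blast
  then show ?thesis
    by (simp add: power2_eq_square algebra_simps)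
qed

text \<open>
  With \<open>M t = exp (integral {a..t} \<mu>)\<close> as integrating factor, the derivative of \<open>E * M\<close> is
  \<open>(E' + \<mu> E) M \<le> g M\<close>, so \<open>E * M\<close> minus the primitive of \<open>g * M\<close> decreases.
\<close>

lemma linear_differential_inequality:
  fixes E E' \<mu> g :: "real \<Rightarrow> real"
  assumes "a \<le> b"
    and E: "\<And>t. t \<in> {a..b} \<Longrightarrow> (E has_real_derivative E' t) (at t within {a..b})"
    and \<mu>: "continuous_on {a..b} \<mu>" and g: "continuous_on {a..b} g"
    and le: "\<And>t. t \<in> {a..b} \<Longrightarrow> E' t + \<mu> t * E t \<le> g t"
  shows "E b * exp (integral {a..b} \<mu>)
      \<le> E a + integral {a..b} (\<lambda>t. g t * exp (integral {a..t} \<mu>))"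
proof -
  define M where "M t = exp (integral {a..t} \<mu>)" for t
  define h where "h t = E t * M t - integral {a..t} (\<lambda>s. g s * M s)" for t
  have M': "(M has_real_derivative \<mu> t * M t) (at t within {a..b})" if "t \<in> {a..b}" for t
    unfolding M_def using integral_has_real_derivative[OF \<mu> that]
    by (auto intro!: derivative_eq_intros)
  then have "continuous_on {a..b} M"
    by (intro DERIV_continuous_on) auto
  then have "continuous_on {a..b} (\<lambda>s. g s * M s)"
    using g by (intro continuous_intros)
  then have h': "(h has_real_derivative (E' t + \<mu> t * E t - g t) * M t) (at t within {a..b})"
    if "t \<in> {a..b}" for t
    unfolding h_def using that
    by (auto intro!: derivative_eq_intros E M' integral_has_real_derivative simp: algebra_simps)
  have "h b \<le> h a"
  proof (rule DERIV_nonpos_imp_decreasing_open[OF \<open>a \<le> b\<close>])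
    show "continuous_on {a..b} h"
      using h' by (intro DERIV_continuous_on) auto
    fix t
    assume "a < t" "t < b"
    then have "(h has_real_derivative (E' t + \<mu> t * E t - g t) * M t) (at t)"
      using h'[of t] by (simp add: at_within_Icc_at)
    moreover have "(E' t + \<mu> t * E t - g t) * M t \<le> 0"
      using le[of t] \<open>a < t\<close> \<open>t < b\<close> by (intro mult_nonpos_nonneg) (auto simp: M_def)
    ultimately show "\<exists>y. (h has_real_derivative y) (at t) \<and> y \<le> 0"
      by blast
  qed
  then show ?thesis
    by (simp add: h_def M_def)
qed

section \<open>Dissipation of the energy\<close>

text \<open>
  The pointwise core of the argument: \<open>a\<close> stands for \<open>sqrt \<epsilon>\<close>, \<open>r\<close> for the derivative of \<open>1/a\<close>, so
  that \<open>a' = - r a\<^sup>2\<close>, \<open>\<epsilon>'/2 = - r a\<^sup>3\<close> and \<open>\<mu> = a (r + \<delta> - K)\<close>; \<open>w\<close> is the velocity and \<open>G\<close> the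
  gradient at the current position \<open>p\<close>, and \<open>z\<close> is the minimizer. The three summands before the
  rate are the derivative of the energy along the equation of motion.
\<close>

lemma energy_dissipation:
  fixes p w z G :: "'a::real_inner"
  assumes "0 < a" "0 < K" "0 \<le> r" "r \<le> 2 * K - \<delta>" "r \<le> \<delta> - K" "K * (\<delta> - K) \<le> 1"
    and minimum: "fz \<le> fp" and gradient: "fp + inner G (z - p) \<le> fz"
  shows "inner G w + (a\<^sup>2 * inner p w - r * a ^ 3 * (norm p)\<^sup>2)
      + inner ((K * a) *\<^sub>R (p - z) + w)
          ((K * a) *\<^sub>R w - (K * r * a\<^sup>2) *\<^sub>R (p - z) - (\<delta> * a) *\<^sub>R w - G - a\<^sup>2 *\<^sub>R p)
      + a * (r + \<delta> - K)
        * (fp - fz + a\<^sup>2 / 2 * (norm p)\<^sup>2 + 1 / 2 * (norm ((K * a) *\<^sub>R (p - z) + w))\<^sup>2)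
    \<le> K / 2 * a ^ 3 * (norm z)\<^sup>2"
    (is "?lhs \<le> ?rhs")
proof -
  define d where "d = p - z"
  have p: "p = z + d"
    by (simp add: d_def)
  \<comment> \<open>The choice of rate makes the coefficient of \<open>inner d w\<close> vanish:
      \<open>K (K - \<delta>) - K r + K (r + \<delta> - K) = 0\<close>, after division by \<open>a\<^sup>2\<close>. The remaining mixed term
      \<open>inner p d\<close> is eliminated by polarization, \<open>2 inner p d = \<parallel>p\<parallel>\<^sup>2 + \<parallel>d\<parallel>\<^sup>2 - \<parallel>z\<parallel>\<^sup>2\<close>, which produces
      the source term.\<close>
  have "?rhs - ?lhs = K * a * (inner G d - (fp - fz)) + a * (2 * K - \<delta> - r) * (fp - fz)
      + a ^ 3 * (r + (2 * K - \<delta> - r) / 2) * (norm p)\<^sup>2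
      + K * a ^ 3 / 2 * (K * r + (1 - K * (\<delta> - K))) * (norm d)\<^sup>2
      + a / 2 * (\<delta> - K - r) * (norm w)\<^sup>2"
    unfolding p power2_norm_eq_inner
    by (simp add: inner_simps inner_commute[of d z] inner_commute[of w d] inner_commute[of w z]
        inner_commute[of w G] inner_commute[of d G] inner_commute[of z G]
        power2_eq_square power3_eq_cube field_simps)
  also have "\<dots> \<ge> 0"
    using assms by (intro add_nonneg_nonneg mult_nonneg_nonneg)
      (auto simp: d_def inner_diff_right)
  finally show ?thesis
    by simp
qed

section \<open>The convergence rate\<close>

theorem theorem5:
  fixes f :: "'a::{real_inner, complete_space} \<Rightarrow> real"
    and gradf :: "'a \<Rightarrow> 'a"
    and xstar :: 'a
    and eps eps' :: "real \<Rightarrow> real"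
    and x x' x'' :: "real \<Rightarrow> 'a"
    and t0 t1 \<delta> K :: real
  assumes f_convex: "convex_on UNIV f"
    and f_grad: "\<And>y. GDERIV f y :> gradf y"
    and grad_lipschitz: "lipschitz_on_bounded_sets gradf"
    and S_nonempty: "argmin_set f \<noteq> {}"
    and xstar_min_norm: "is_arg_min norm (\<lambda>z. z \<in> argmin_set f) xstar"
    and eps: "regularization_parameter t0 eps eps'"
    and \<delta>_pos: "0 < \<delta>"
    and sol: "solution_trajectory t0 \<delta> eps gradf x x' x''"
    and K_pos: "0 < K"
    and CD: "controlled_decay_from t0 \<delta> K eps t1"
  shows "\<forall>t\<ge>t1.
    f (x t) - (INF y. f y)
      \<le> K * (norm xstar)\<^sup>2 / 2 * (1 / M_fun \<delta> K eps eps' t1 t)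
            * integral {t1..t} (\<lambda>s. eps s powr (3 / 2) * M_fun \<delta> K eps eps' t1 s)
          + C_const K f eps x x' xstar t1 / M_fun \<delta> K eps eps' t1 t"
proof (intro allI impI)
  fix T
  assume T: "t1 \<le> T"
  define \<mu> where "\<mu> = \<mu>_fun \<delta> K eps eps'"
  define a where "a t = sqrt (eps t)" for t
  define r where "r t = - eps' t / (2 * a t ^ 3)" for t
  define v where "v t = (K * a t) *\<^sub>R (x t - xstar) + x' t" for t
  define v' where "v' t = (K * a t) *\<^sub>R x' t - (K * r t * (a t)\<^sup>2) *\<^sub>R (x t - xstar)
      - (\<delta> * a t) *\<^sub>R x' t - gradf (x t) - (a t)\<^sup>2 *\<^sub>R x t" for t
  define E where "E t = f (x t) - f xstar + (a t)\<^sup>2 / 2 * (norm (x t))\<^sup>2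
      + 1 / 2 * (norm (v t))\<^sup>2" for t
  define E' where "E' t = inner (gradf (x t)) (x' t)
      + ((a t)\<^sup>2 * inner (x t) (x' t) - r t * a t ^ 3 * (norm (x t))\<^sup>2) + inner (v t) (v' t)" for t
  have "t0 \<le> t1" and adm: "admissible_K \<delta> K"
    using CD by (auto simp: controlled_decay_from_def)
  have minimal: "f xstar \<le> f y" for y
    using xstar_min_norm
    by (auto simp: argmin_set_def is_arg_min_linorder)
  have eps_pos: "0 < eps t" if "t0 \<le> t" for t
    using eps that by (simp add: regularization_parameter_def)
  have a_pos: "0 < a t" if "t0 \<le> t" for t
    using eps_pos[OF that] by (simp add: a_def)
  have a_sq: "(a t)\<^sup>2 = eps t" if "t0 \<le> t" for t
    using eps_pos[OF that] by (simp add: a_def)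
  have eps': "(eps has_real_derivative eps' t) (at t within {t0..})" if "t0 \<le> t" for t
    using eps that by (simp add: regularization_parameter_def)
  have eps'_r: "eps' t = - 2 * r t * a t ^ 3" if "t0 \<le> t" for t
    using a_pos[OF that] by (simp add: r_def)
  have a': "(a has_real_derivative - r t * (a t)\<^sup>2) (at t within {t0..})" if "t0 \<le> t" for t
  proof -
    have "(a has_real_derivative eps' t * (inverse (sqrt (eps t)) / 2)) (at t within {t0..})"
      unfolding a_def using eps'[OF that] eps_pos[OF that]
      by (auto intro!: derivative_eq_intros)
    also have "eps' t * (inverse (sqrt (eps t)) / 2) = - r t * (a t)\<^sup>2"
      using a_pos[OF that] unfolding a_def[symmetric] eps'_r[OF that]
      by (simp add: field_simps power2_eq_square power3_eq_cube)
    finally show ?thesis .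
  qed
  have r_nonneg: "0 \<le> r t" if "t0 \<le> t" for t
  proof -
    have "eps' t \<le> 0"
      using antimono_on_atLeast_derivative_nonpos[OF _ eps'[OF that] that] eps
      by (simp add: regularization_parameter_def)
    then show ?thesis
      using a_pos[OF that] by (simp add: r_def divide_nonpos_pos)
  qed
  \<comment> \<open>Controlled decay bounds some derivative of \<open>1 / a\<close>; uniqueness of derivatives, one-sided ones at
      \<open>t0\<close> included, identifies it with \<open>r\<close>.\<close>
  have r_le: "r t \<le> min (2 * K - \<delta>) (\<delta> - K)" if t1: "t1 \<le> t" for t
  proof -
    have t: "t0 \<le> t"
      using t1 \<open>t0 \<le> t1\<close> by simp
    obtain D where D: "((\<lambda>s. 1 / a s) has_real_derivative D) (at t within {t0..})"
        "D \<le> min (2 * K - \<delta>) (\<delta> - K)"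
      using CD t1 unfolding controlled_decay_from_def a_def by blast
    have "((\<lambda>s. 1 / a s) has_real_derivative r t) (at t within {t0..})"
      using a'[OF t] a_pos[OF t]
      by (auto intro!: derivative_eq_intros simp: power2_eq_square)
    moreover have "at t within {t0..} \<noteq> bot"
      using t at_within_atLeast_neq_bot by blast
    ultimately have "D = r t"
      using D(1) tendsto_unique unfolding has_field_derivative_iff by blast
    then show ?thesis
      using D(2) by simp
  qed
  have \<mu>_eq: "\<mu> t = a t * (r t + \<delta> - K)" if "t0 \<le> t" for t
    using a_pos[OF that] unfolding \<mu>_def \<mu>_fun_def eps'_r[OF that] a_sq[OF that, symmetric]
    by (simp add: power2_eq_square power3_eq_cube field_simps)
  have E_deriv: "(E has_real_derivative E' t) (at t within {t0..})" if "t0 \<le> t" for t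
  proof -
    have x': "(x has_vector_derivative x' t) (at t within {t0..})"
      and x'': "(x' has_vector_derivative x'' t) (at t within {t0..})"
      and ode: "x'' t = - (\<delta> * a t) *\<^sub>R x' t - gradf (x t) - (a t)\<^sup>2 *\<^sub>R x t"
      using sol that a_sq[OF that]
      by (auto simp: solution_trajectory_def a_def eq_neg_iff_add_eq_0 algebra_simps)
    have "(v has_vector_derivative v' t) (at t within {t0..})"
      unfolding v_def v'_def
      by (auto intro!: derivative_eq_intros a'[OF that] x' x'' simp: ode algebra_simps)
    then have v2: "((\<lambda>s. (norm (v s))\<^sup>2) has_real_derivative 2 * inner (v t) (v' t))
        (at t within {t0..})"
      unfolding power2_norm_eq_inner has_vector_derivative_def has_field_derivative_def
      by (auto intro!: derivative_eq_intros simp: inner_commute)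
    have x2: "((\<lambda>s. (norm (x s))\<^sup>2) has_real_derivative 2 * inner (x t) (x' t))
        (at t within {t0..})"
      using x' unfolding power2_norm_eq_inner has_vector_derivative_def has_field_derivative_def
      by (auto intro!: derivative_eq_intros simp: inner_commute)
    have "((\<lambda>s. f (x s)) has_derivative (\<lambda>s. inner (s *\<^sub>R x' t) (gradf (x t))))
        (at t within {t0..})"
      using f_grad[of "x t"] x' unfolding gderiv_def has_vector_derivative_def
      by (rule has_derivative_compose[rotated])
    then have fx: "((\<lambda>s. f (x s)) has_real_derivative inner (gradf (x t)) (x' t))
        (at t within {t0..})"
      by (simp add: has_field_derivative_def inner_commute mult_commute_abs)
    have a2: "((\<lambda>s. (a s)\<^sup>2 / 2) has_real_derivative - r t * a t ^ 3) (at t within {t0..})"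
      by (auto intro!: derivative_eq_intros a'[OF that] simp: power2_eq_square power3_eq_cube)
    show ?thesis
      unfolding E_def
      by (rule DERIV_cong[OF DERIV_add[OF DERIV_add[OF DERIV_diff[OF fx DERIV_const]
              DERIV_mult[OF a2 x2]] DERIV_cmult[OF v2]]])
        (simp add: E'_def)
  qed
  have dissipation: "E' t + \<mu> t * E t \<le> K * (norm xstar)\<^sup>2 / 2 * eps t powr (3 / 2)"
    if "t1 \<le> t" for t
  proof -
    have t: "t0 \<le> t"
      using that \<open>t0 \<le> t1\<close> by simp
    have "eps t powr (3 / 2) = a t ^ 3"
      using a_pos[OF t] eps_pos[OF t]
      by (simp add: a_def powr_half_sqrt[symmetric] powr_powr flip: powr_realpow)
    moreover have "E' t + \<mu> t * E t \<le> K / 2 * a t ^ 3 * (norm xstar)\<^sup>2"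
      unfolding \<mu>_eq[OF t] E_def E'_def v_def v'_def
      using r_le[OF that]
      by (intro energy_dissipation a_pos[OF t] K_pos r_nonneg[OF t] minimal
          admissible_K_imp_product_le_1[OF adm \<delta>_pos]
          convex_on_gradient_inequality[OF f_convex f_grad]) auto
    ultimately show ?thesis
      by (simp add: mult_ac)
  qed
  have sub: "{t1..T} \<subseteq> {t0..}"
    using \<open>t0 \<le> t1\<close> by auto
  have cont_eps: "continuous_on {t1..T} eps"
    using has_field_derivative_subset[OF eps' sub] \<open>t0 \<le> t1\<close>
    by (intro DERIV_continuous_on[where D = eps']) auto
  have "continuous_on {t1..T} eps'"
    using eps sub by (auto simp: regularization_parameter_def intro: continuous_on_subset)
  then have cont_\<mu>: "continuous_on {t1..T} \<mu>"
    unfolding \<mu>_def \<mu>_fun_def using cont_eps sub eps_pos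
    by (intro continuous_intros) (auto simp: less_imp_neq[symmetric])
  have "E T * exp (integral {t1..T} \<mu>) \<le> E t1 + integral {t1..T}
      (\<lambda>t. K * (norm xstar)\<^sup>2 / 2 * eps t powr (3 / 2) * exp (integral {t1..t} \<mu>))"
  proof (rule linear_differential_inequality[OF T _ cont_\<mu>])
    show "(E has_real_derivative E' t) (at t within {t1..T})" if "t \<in> {t1..T}" for t
      using has_field_derivative_subset[OF E_deriv sub] that \<open>t0 \<le> t1\<close> by auto
    show "continuous_on {t1..T} (\<lambda>t. K * (norm xstar)\<^sup>2 / 2 * eps t powr (3 / 2))"
      using cont_eps sub eps_pos by (intro continuous_intros) (auto simp: less_imp_neq[symmetric])
  qed (use dissipation in auto)
  also have "E t1 = C_const K f eps x x' xstar t1"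
    by (simp add: E_def C_const_def v_def a_sq[OF \<open>t0 \<le> t1\<close>]) (simp add: a_def)
  finally have "E T * M_fun \<delta> K eps eps' t1 T \<le> C_const K f eps x x' xstar t1
      + K * (norm xstar)\<^sup>2 / 2 * integral {t1..T} (\<lambda>s. eps s powr (3 / 2) * M_fun \<delta> K eps eps' t1 s)"
    by (simp add: M_fun_def \<mu>_def mult.assoc)
  moreover have "0 < M_fun \<delta> K eps eps' t1 T"
    by (simp add: M_fun_def)
  ultimately have "E T \<le> K * (norm xstar)\<^sup>2 / 2 * (1 / M_fun \<delta> K eps eps' t1 T)
        * integral {t1..T} (\<lambda>s. eps s powr (3 / 2) * M_fun \<delta> K eps eps' t1 s)
      + C_const K f eps x x' xstar t1 / M_fun \<delta> K eps eps' t1 T"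
    by (simp add: field_simps)
  moreover have "f (x T) - f xstar \<le> E T"
    by (simp add: E_def)
  moreover have "(INF y. f y) = f xstar"
    using minimal by (intro cInf_eq_minimum) auto
  ultimately show "f (x T) - (INF y. f y)
      \<le> K * (norm xstar)\<^sup>2 / 2 * (1 / M_fun \<delta> K eps eps' t1 T)
          * integral {t1..T} (\<lambda>s. eps s powr (3 / 2) * M_fun \<delta> K eps eps' t1 s)
        + C_const K f eps x x' xstar t1 / M_fun \<delta> K eps eps' t1 T"
    by simp
qed

end
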